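(* Let $M$ be a smooth manifold, $h$ a non-degenerate $(0,2)$-tensor field on $M$ and $\nabla$ an affine connection on $M$. Let $h^H$ be the horizontal lift of $h$ to $TM$ with respect to $\nabla$, let $\Psi^\nabla:TM\oplus T^*M\to T(TM)$ be the bundle morphism $\Psi^\nabla(X+\alpha)=X^H+(h^{-1}(\alpha))^V$, and let $\bar h(\sigma,\tau)=h^H(\Psi^\nabla(\sigma),\Psi^\nabla(\tau))$ be the pull-back tensor on $TM\oplus T^*M$. If $h$ is symmetric, then $\bar h=-2\langle\cdot,\cdot\rangle$. If $h$ is skew-symmetric, then $\bar h=-2(\cdot,\cdot)$. Here $\langle X+\alpha,Y+\beta\rangle=-\frac12(\alpha(Y)+\beta(X))$ and $(X+\alpha,Y+\beta)=-\frac12(\alpha(Y)-\beta(X))$.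
   Context: $h$ also denotes the isomorphism $TM\to T^*M$, $h(X)=h(X,\cdot)$, with inverse $h^{-1}$. With coordinates $(\tilde x^i,y^i)$ on $TM$ induced by coordinates $(x^i)$ on $M$ and $\nabla_{\partial/\partial x^i}\partial/\partial x^j=\Gamma^k_{ij}\partial/\partial x^k$, the horizontal lift of a vector field $X=X^i\partial/\partial x^i$ is $X^H=X^i\big(\partial/\partial\tilde x^i-y^k\Gamma^l_{ik}\,\partial/\partial y^l\big)$ and its vertical lift is $X^V=X^i\partial/\partial y^i$. At each $a\in TM$ over $p\in M$, $\Psi^\nabla$ maps $T_pM\oplus T_p^*M$ isomorphically onto $T_a(TM)$. The horizontal lift $h^H$ is the $(0,2)$-tensor field on $TM$ with $h^H(X^H,Y^H)=0$, $h^H(X^V,Y^V)=0$, $h^H(X^H,Y^V)=h(X,Y)$ and $h^H(X^V,Y^H)=h(X,Y)$ for vector fields $X,Y$ on $M$. *)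

theory Defs
  imports "HOL-Analysis.Analysis"
begin

section \<open>Smooth maps and manifolds\<close>

text \<open>The sets \<open>S\<close> are open wherever this is used, and the spaces finite-dimensional.\<close>

primrec Ck_on :: "nat \<Rightarrow> 'e::real_normed_vector set \<Rightarrow> ('e \<Rightarrow> 'f::real_normed_vector) \<Rightarrow> bool" where
  "Ck_on 0 S f \<longleftrightarrow> continuous_on S f"
| "Ck_on (Suc k) S f \<longleftrightarrow> (\<forall>x\<in>S. f differentiable (at x)) \<and>
     (\<forall>v. Ck_on k S (\<lambda>x. frechet_derivative f (at x) v))"

definition smooth_on :: "'e::real_normed_vector set \<Rightarrow> ('e \<Rightarrow> 'f::real_normed_vector) \<Rightarrow> bool" where
  "smooth_on S f \<longleftrightarrow> (\<forall>k. Ck_on k S f)"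

text \<open>A chart is its domain together with its coordinate map; the values of the map outside the
  domain are irrelevant. The model space is an arbitrary finite-dimensional inner product space
  rather than a \<open>euclidean_space\<close>, because that class excludes dimension 0. Formulas in
  coordinates are written without indices: \<open>w\<close> in the model space stands for the coefficients
  \<open>(w\<^sup>i)\<close> of \<open>w\<^sup>i \<partial>/\<partial>x\<^sup>i\<close>.\<close>

type_synonym ('a, 'e) chart = "'a set \<times> ('a \<Rightarrow> 'e)"

abbreviation chart_inv :: "('a, 'e) chart \<Rightarrow> 'e \<Rightarrow> 'a" where
  "chart_inv c \<equiv> inv_into (fst c) (snd c)"

abbreviation chart_image :: "('a, 'e) chart \<Rightarrow> 'e set" where
  "chart_image c \<equiv> snd c ` fst c"

definition transition :: "('a, 'e) chart \<Rightarrow> ('a, 'e) chart \<Rightarrow> 'e \<Rightarrow> 'e" where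
  "transition c d = snd d \<circ> chart_inv c"

definition smooth_manifold :: "'a topology \<Rightarrow> ('a, 'e::real_inner) chart set \<Rightarrow> bool" where
  "smooth_manifold M A \<longleftrightarrow>
     (\<exists>B::'e set. finite B \<and> span B = UNIV) \<and>
     Hausdorff_space M \<and> second_countable M \<and>
     topspace M = \<Union> (fst ` A) \<and>
     (\<forall>c\<in>A. openin M (fst c) \<and> open (chart_image c) \<and>
        homeomorphic_map (subtopology M (fst c)) (top_of_set (chart_image c)) (snd c)) \<and>
     (\<forall>c\<in>A. \<forall>d\<in>A. smooth_on (snd c ` (fst c \<inter> fst d)) (transition c d))"

text \<open>Some chart around \<open>p\<close>. It serves to define objects given by coordinate formulas that do not
  depend on the coordinates.\<close>

definition chart_at :: "('a, 'e) chart set \<Rightarrow> 'a \<Rightarrow> ('a, 'e) chart" where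
  "chart_at A p = (SOME c. c \<in> A \<and> p \<in> fst c)"

section \<open>Tangent vectors, fields and tensors\<close>

text \<open>A tangent vector at \<open>p\<close> is the family of its components in all charts around \<open>p\<close>, related by
  the Jacobians of the transition maps; it is 0 at all other charts, so that tangent vectors are
  determined by their components. Only charts are used, so the same notions apply to \<open>M\<close> and to
  the manifold \<open>TM\<close>.\<close>

type_synonym ('a, 'e) tvec = "('a, 'e) chart \<Rightarrow> 'e"

definition tangent_space :: "('a, 'e::real_normed_vector) chart set \<Rightarrow> 'a \<Rightarrow> ('a, 'e) tvec set" where
  "tangent_space A p = {v.
     (\<forall>c. \<not> (c \<in> A \<and> p \<in> fst c) \<longrightarrow> v c = 0) \<and>
     (\<forall>c\<in>A. \<forall>d\<in>A. p \<in> fst c \<inter> fst d \<longrightarrow>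
        v d = frechet_derivative (transition c d) (at (snd c p)) (v c))}"

definition vadd :: "('a, 'e::real_normed_vector) tvec \<Rightarrow> ('a, 'e) tvec \<Rightarrow> ('a, 'e) tvec" where
  "vadd u v = (\<lambda>c. u c + v c)"

definition vscale :: "real \<Rightarrow> ('a, 'e::real_normed_vector) tvec \<Rightarrow> ('a, 'e) tvec" where
  "vscale r u = (\<lambda>c. r *\<^sub>R u c)"

text \<open>The tangent vector at \<open>p\<close> whose components in the chart \<open>c\<close> are \<open>w\<close>.\<close>

definition tangent_of ::
  "('a, 'e::real_normed_vector) chart set \<Rightarrow> ('a, 'e) chart \<Rightarrow> 'a \<Rightarrow> 'e \<Rightarrow> ('a, 'e) tvec" where
  "tangent_of A c p w = (\<lambda>d. if d \<in> A \<and> p \<in> fst d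
     then frechet_derivative (transition c d) (at (snd c p)) w else 0)"

definition cotangent_space ::
  "('a, 'e::real_normed_vector) chart set \<Rightarrow> 'a \<Rightarrow> (('a, 'e) tvec \<Rightarrow> real) set" where
  "cotangent_space A p = {\<alpha>.
     (\<forall>u\<in>tangent_space A p. \<forall>v\<in>tangent_space A p. \<alpha> (vadd u v) = \<alpha> u + \<alpha> v) \<and>
     (\<forall>u\<in>tangent_space A p. \<forall>r. \<alpha> (vscale r u) = r * \<alpha> u)}"

definition smooth_function :: "('a, 'e::real_normed_vector) chart set \<Rightarrow> ('a \<Rightarrow> real) \<Rightarrow> bool" where
  "smooth_function A f \<longleftrightarrow> (\<forall>c\<in>A. smooth_on (chart_image c) (f \<circ> chart_inv c))"

text \<open>Outside the manifold the tangent space is \<open>{0}\<close>, so vector fields vanish there.\<close>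

definition vector_field ::
  "('a, 'e::real_normed_vector) chart set \<Rightarrow> ('a \<Rightarrow> ('a, 'e) tvec) \<Rightarrow> bool" where
  "vector_field A X \<longleftrightarrow> (\<forall>p. X p \<in> tangent_space A p) \<and>
     (\<forall>c\<in>A. smooth_on (chart_image c) (\<lambda>x. X (chart_inv c x) c))"

text \<open>The derivative of \<open>f\<close> at \<open>p\<close> along the tangent vector \<open>v\<close>.\<close>

definition dir_deriv ::
  "('a, 'e::real_normed_vector) chart set \<Rightarrow> ('a \<Rightarrow> real) \<Rightarrow> 'a \<Rightarrow> ('a, 'e) tvec \<Rightarrow> real" where
  "dir_deriv A f p v =
     (let c = chart_at A p in frechet_derivative (f \<circ> chart_inv c) (at (snd c p)) (v c))"

type_synonym ('a, 'e) tensor02 = "'a \<Rightarrow> ('a, 'e) tvec \<Rightarrow> ('a, 'e) tvec \<Rightarrow> real"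

definition tensor_field02 ::
  "('a, 'e::real_normed_vector) chart set \<Rightarrow> ('a, 'e) tensor02 \<Rightarrow> bool" where
  "tensor_field02 A h \<longleftrightarrow>
     (\<forall>p \<in> \<Union> (fst ` A). \<forall>u\<in>tangent_space A p.
        h p u \<in> cotangent_space A p \<and> (\<lambda>w. h p w u) \<in> cotangent_space A p) \<and>
     (\<forall>c\<in>A. \<forall>u w. smooth_on (chart_image c)
        (\<lambda>x. let p = chart_inv c x in h p (tangent_of A c p u) (tangent_of A c p w)))"

definition nondegenerate ::
  "('a, 'e::real_normed_vector) chart set \<Rightarrow> ('a, 'e) tensor02 \<Rightarrow> bool" where
  "nondegenerate A h \<longleftrightarrow> (\<forall>p \<in> \<Union> (fst ` A). \<forall>u\<in>tangent_space A p.
     (\<forall>w\<in>tangent_space A p. h p u w = 0) \<longrightarrow> u = (\<lambda>_. 0))"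

definition symmetric_tensor ::
  "('a, 'e::real_normed_vector) chart set \<Rightarrow> ('a, 'e) tensor02 \<Rightarrow> bool" where
  "symmetric_tensor A h \<longleftrightarrow> (\<forall>p \<in> \<Union> (fst ` A).
     \<forall>u\<in>tangent_space A p. \<forall>w\<in>tangent_space A p. h p u w = h p w u)"

definition skew_symmetric_tensor ::
  "('a, 'e::real_normed_vector) chart set \<Rightarrow> ('a, 'e) tensor02 \<Rightarrow> bool" where
  "skew_symmetric_tensor A h \<longleftrightarrow> (\<forall>p \<in> \<Union> (fst ` A).
     \<forall>u\<in>tangent_space A p. \<forall>w\<in>tangent_space A p. h p u w = - h p w u)"

text \<open>The inverse of the isomorphism \<open>u \<mapsto> h(u, \<cdot>)\<close> at \<open>p\<close>.\<close>

definition tensor_inv ::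
  "('a, 'e::real_normed_vector) chart set \<Rightarrow> ('a, 'e) tensor02 \<Rightarrow> 'a \<Rightarrow>
     (('a, 'e) tvec \<Rightarrow> real) \<Rightarrow> ('a, 'e) tvec" where
  "tensor_inv A h p \<alpha> =
     (THE u. u \<in> tangent_space A p \<and> (\<forall>w\<in>tangent_space A p. h p u w = \<alpha> w))"

section \<open>Affine connections\<close>

type_synonym ('a, 'e) connection =
  "('a \<Rightarrow> ('a, 'e) tvec) \<Rightarrow> ('a \<Rightarrow> ('a, 'e) tvec) \<Rightarrow> 'a \<Rightarrow> ('a, 'e) tvec"

definition affine_connection ::
  "('a, 'e::real_normed_vector) chart set \<Rightarrow> ('a, 'e) connection \<Rightarrow> bool" where
  "affine_connection A nabla \<longleftrightarrow>
     (\<forall>X Y. vector_field A X \<longrightarrow> vector_field A Y \<longrightarrow> vector_field A (nabla X Y)) \<and>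
     (\<forall>X X' Y. vector_field A X \<longrightarrow> vector_field A X' \<longrightarrow> vector_field A Y \<longrightarrow>
        nabla (\<lambda>p. vadd (X p) (X' p)) Y = (\<lambda>p. vadd (nabla X Y p) (nabla X' Y p))) \<and>
     (\<forall>X Y Y'. vector_field A X \<longrightarrow> vector_field A Y \<longrightarrow> vector_field A Y' \<longrightarrow>
        nabla X (\<lambda>p. vadd (Y p) (Y' p)) = (\<lambda>p. vadd (nabla X Y p) (nabla X Y' p))) \<and>
     (\<forall>f X Y. smooth_function A f \<longrightarrow> vector_field A X \<longrightarrow> vector_field A Y \<longrightarrow>
        nabla (\<lambda>p. vscale (f p) (X p)) Y = (\<lambda>p. vscale (f p) (nabla X Y p))) \<and>
     (\<forall>f X Y. smooth_function A f \<longrightarrow> vector_field A X \<longrightarrow> vector_field A Y \<longrightarrow>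
        nabla X (\<lambda>p. vscale (f p) (Y p)) =
          (\<lambda>p. vadd (vscale (dir_deriv A f p (X p)) (Y p)) (vscale (f p) (nabla X Y p))))"

text \<open>\<open>christoffel A nabla c p u w\<close> has the components \<open>\<Gamma>\<^sup>k\<^sub>i\<^sub>j(p) u\<^sup>i w\<^sup>j\<close>, the Christoffel symbols
  being those of the chart \<open>c\<close>: it is the covariant derivative of \<open>w\<^sup>j \<partial>/\<partial>x\<^sup>j\<close> along \<open>u\<^sup>i \<partial>/\<partial>x\<^sup>i\<close>,
  the \<open>u\<^sup>i\<close> and \<open>w\<^sup>j\<close> being constants. As a connection is an operator on global vector fields, these
  coordinate fields are replaced by global ones that agree with them near \<open>p\<close>; the result does not
  depend on which.\<close>

definition christoffel ::
  "('a, 'e::real_normed_vector) chart set \<Rightarrow> ('a, 'e) connection \<Rightarrow>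
     ('a, 'e) chart \<Rightarrow> 'a \<Rightarrow> 'e \<Rightarrow> 'e \<Rightarrow> 'e" where
  "christoffel A nabla c p u w = (THE z. \<exists>U W S.
     vector_field A U \<and> vector_field A W \<and>
     open S \<and> snd c p \<in> S \<and> (\<forall>q\<in>fst c. snd c q \<in> S \<longrightarrow> U q c = u \<and> W q c = w) \<and>
     z = nabla U W p c)"

section \<open>The tangent bundle and lifts\<close>

text \<open>The charts \<open>(x\<^sup>i, y\<^sup>i)\<close> of \<open>TM\<close>, whose points are the pairs \<open>(p, v)\<close> with \<open>v\<close> tangent at \<open>p\<close>.\<close>

definition tangent_chart ::
  "('a, 'e::real_normed_vector) chart set \<Rightarrow> ('a, 'e) chart \<Rightarrow> ('a \<times> ('a, 'e) tvec, 'e \<times> 'e) chart" where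
  "tangent_chart A c =
     ({(p, v). p \<in> fst c \<and> v \<in> tangent_space A p}, (\<lambda>(p, v). (snd c p, v c)))"

definition tangent_atlas ::
  "('a, 'e::real_normed_vector) chart set \<Rightarrow> ('a \<times> ('a, 'e) tvec, 'e \<times> 'e) chart set" where
  "tangent_atlas A = tangent_chart A ` A"

definition tangent_bundle ::
  "('a, 'e::real_normed_vector) chart set \<Rightarrow> ('a \<times> ('a, 'e) tvec) set" where
  "tangent_bundle A = (SIGMA p : \<Union> (fst ` A). tangent_space A p)"

text \<open>The lifts to \<open>a = (p, v)\<close> of a tangent vector \<open>u\<close> at \<open>p\<close>. In the coordinates of \<open>TM\<close> induced
  by a chart of \<open>M\<close>, the point \<open>a\<close> has fibre coordinates \<open>y = v c\<close>, the horizontal lift has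
  components \<open>(u\<^sup>i, - u\<^sup>i y\<^sup>k \<Gamma>\<^sup>l\<^sub>i\<^sub>k)\<close> and the vertical lift \<open>(0, u\<^sup>i)\<close>. Both are independent of the
  chart.\<close>

definition hlift ::
  "('a, 'e::real_normed_vector) chart set \<Rightarrow> ('a, 'e) connection \<Rightarrow> ('a, 'e) tvec \<Rightarrow>
     'a \<times> ('a, 'e) tvec \<Rightarrow> ('a \<times> ('a, 'e) tvec, 'e \<times> 'e) tvec" where
  "hlift A nabla u a = (let c = chart_at A (fst a) in
     tangent_of (tangent_atlas A) (tangent_chart A c) a
       (u c, - christoffel A nabla c (fst a) (u c) (snd a c)))"

definition vlift ::
  "('a, 'e::real_normed_vector) chart set \<Rightarrow> ('a, 'e) tvec \<Rightarrow>
     'a \<times> ('a, 'e) tvec \<Rightarrow> ('a \<times> ('a, 'e) tvec, 'e \<times> 'e) tvec" where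
  "vlift A u a = (let c = chart_at A (fst a) in
     tangent_of (tangent_atlas A) (tangent_chart A c) a (0, u c))"

definition horizontal_lift_field ::
  "('a, 'e::real_normed_vector) chart set \<Rightarrow> ('a, 'e) connection \<Rightarrow> ('a \<Rightarrow> ('a, 'e) tvec) \<Rightarrow>
     'a \<times> ('a, 'e) tvec \<Rightarrow> ('a \<times> ('a, 'e) tvec, 'e \<times> 'e) tvec" where
  "horizontal_lift_field A nabla X = (\<lambda>a. hlift A nabla (X (fst a)) a)"

definition vertical_lift_field ::
  "('a, 'e::real_normed_vector) chart set \<Rightarrow> ('a \<Rightarrow> ('a, 'e) tvec) \<Rightarrow>
     'a \<times> ('a, 'e) tvec \<Rightarrow> ('a \<times> ('a, 'e) tvec, 'e \<times> 'e) tvec" where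
  "vertical_lift_field A X = (\<lambda>a. vlift A (X (fst a)) a)"

text \<open>\<open>hH\<close> is the horizontal lift of \<open>h\<close>; these conditions determine it on \<open>TM\<close>.\<close>

definition is_horizontal_lift ::
  "('a, 'e::real_normed_vector) chart set \<Rightarrow> ('a, 'e) connection \<Rightarrow> ('a, 'e) tensor02 \<Rightarrow>
     ('a \<times> ('a, 'e) tvec, 'e \<times> 'e) tensor02 \<Rightarrow> bool" where
  "is_horizontal_lift A nabla h hH \<longleftrightarrow>
     tensor_field02 (tangent_atlas A) hH \<and>
     (\<forall>X Y. vector_field A X \<longrightarrow> vector_field A Y \<longrightarrow> (\<forall>a\<in>tangent_bundle A.
        let XH = horizontal_lift_field A nabla X a; XV = vertical_lift_field A X a;
            YH = horizontal_lift_field A nabla Y a; YV = vertical_lift_field A Y a;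
            p = fst a
        in hH a XH YH = 0 \<and> hH a XV YV = 0 \<and>
           hH a XH YV = h p (X p) (Y p) \<and> hH a XV YH = h p (X p) (Y p)))"

section \<open>The generalized tangent bundle\<close>

definition generalized_tangent_space ::
  "('a, 'e::real_normed_vector) chart set \<Rightarrow> 'a \<Rightarrow>
     (('a, 'e) tvec \<times> (('a, 'e) tvec \<Rightarrow> real)) set" where
  "generalized_tangent_space A p = tangent_space A p \<times> cotangent_space A p"

definition pairing_sym ::
  "('a, 'e) tvec \<times> (('a, 'e) tvec \<Rightarrow> real) \<Rightarrow> ('a, 'e) tvec \<times> (('a, 'e) tvec \<Rightarrow> real) \<Rightarrow> real" where
  "pairing_sym = (\<lambda>(X, \<alpha>) (Y, \<beta>). - (1/2) * (\<alpha> Y + \<beta> X))"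

definition pairing_skew ::
  "('a, 'e) tvec \<times> (('a, 'e) tvec \<Rightarrow> real) \<Rightarrow> ('a, 'e) tvec \<times> (('a, 'e) tvec \<Rightarrow> real) \<Rightarrow> real" where
  "pairing_skew = (\<lambda>(X, \<alpha>) (Y, \<beta>). - (1/2) * (\<alpha> Y - \<beta> X))"

text \<open>\<open>Psi A nabla h a\<close> maps the fibre over the base point of \<open>a\<close> into the tangent space of \<open>TM\<close> at
  \<open>a\<close>.\<close>

definition Psi ::
  "('a, 'e::real_normed_vector) chart set \<Rightarrow> ('a, 'e) connection \<Rightarrow> ('a, 'e) tensor02 \<Rightarrow>
     'a \<times> ('a, 'e) tvec \<Rightarrow> ('a, 'e) tvec \<times> (('a, 'e) tvec \<Rightarrow> real) \<Rightarrow>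
     ('a \<times> ('a, 'e) tvec, 'e \<times> 'e) tvec" where
  "Psi A nabla h a = (\<lambda>(X, \<alpha>).
     vadd (hlift A nabla X a) (vlift A (tensor_inv A h (fst a) \<alpha>) a))"

definition hbar ::
  "('a, 'e::real_normed_vector) chart set \<Rightarrow> ('a, 'e) connection \<Rightarrow> ('a, 'e) tensor02 \<Rightarrow>
     ('a \<times> ('a, 'e) tvec, 'e \<times> 'e) tensor02 \<Rightarrow> 'a \<times> ('a, 'e) tvec \<Rightarrow>
     ('a, 'e) tvec \<times> (('a, 'e) tvec \<Rightarrow> real) \<Rightarrow>
     ('a, 'e) tvec \<times> (('a, 'e) tvec \<Rightarrow> real) \<Rightarrow> real" where
  "hbar A nabla h hH a \<sigma> \<tau> = hH a (Psi A nabla h a \<sigma>) (Psi A nabla h a \<tau>)"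

end

theory Submission
  imports Defs "HOL-Real_Asymp.Real_Asymp"
begin

text \<open>On lifts of tangent vectors \<open>X\<close>, \<open>Y\<close> at a point, \<open>h\<^sup>H\<close> takes the values prescribed for vector fields, because
  every tangent vector extends to a global vector field: multiply the constant field of a chart by a
  bump function whose support is compact in the chart, hence closed in the Hausdorff space \<open>M\<close>.
  Bilinearity of \<open>h\<^sup>H\<close> then gives \<open>hbar (X + \<alpha>, Y + \<beta>) = h (X, h\<^sup>-\<^sup>1 \<beta>) + h (h\<^sup>-\<^sup>1 \<alpha>, Y)\<close>; the second
  term is \<open>\<alpha> Y\<close> and the first one is \<open>\<beta> X\<close> up to the sign in the symmetry of \<open>h\<close>. The lifts have to be
  tangent vectors of \<open>TM\<close> for bilinearity to apply, which is the chain rule for the transition maps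
  \<open>(x, y) \<mapsto> (\<phi> x, D\<phi>(x) y)\<close>.\<close>

section \<open>Calculus of smooth maps\<close>

lemma Ck_on_subset: "Ck_on k S f \<Longrightarrow> T \<subseteq> S \<Longrightarrow> Ck_on k T f"
  by (induction k arbitrary: f) (auto intro: continuous_on_subset)

text \<open>Derivatives depend only on the values near a point, so agreement on an open set passes
  to the directional derivatives, to which the induction hypothesis applies.\<close>

lemma Ck_on_cong_open:
  assumes "open S" "\<And>x. x \<in> S \<Longrightarrow> f x = g x" "Ck_on k S f"
  shows "Ck_on k S g"
  using assms(2,3)
proof (induction k arbitrary: f g)
  case 0
  then show ?case by (simp cong: continuous_on_cong)
next
  case (Suc k)
  have d: "(g has_derivative frechet_derivative f (at x)) (at x)" if "x \<in> S" for x
    using has_derivative_transform_within_open[OF _ assms(1) that Suc.prems(1)]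
      Suc.prems(2) that frechet_derivative_works by fastforce
  have "frechet_derivative f (at x) v = frechet_derivative g (at x) v" if "x \<in> S" for x v
    using frechet_derivative_at[OF d[OF that]] by simp
  then have "Ck_on k S (\<lambda>x. frechet_derivative g (at x) v)" for v
    using Suc.IH[of "\<lambda>x. frechet_derivative f (at x) v"] Suc.prems(2) by simp
  then show ?case using d by (auto simp: differentiable_def)
qed

text \<open>Serves to glue smoothness over an open cover. Openness of the pieces enters through
  continuity in the base case; differentiability is already a pointwise condition.\<close>

lemma Ck_on_Union:
  assumes "\<And>T. T \<in> \<T> \<Longrightarrow> open T" "\<And>T. T \<in> \<T> \<Longrightarrow> Ck_on k T f"
  shows "Ck_on k (\<Union>\<T>) f"
  using assms(2)
proof (induction k arbitrary: f)
  case 0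
  then show ?case
    using continuous_on_open_Union[of \<T> f] assms(1) by simp
next
  case (Suc k)
  then show ?case by auto
qed

text \<open>Uniqueness of derivatives identifies an explicit \<open>f'\<close> with
  \<open>frechet_derivative\<close>, so that inductions can work with formulas for the
  derivative.\<close>

lemma Ck_on_SucI:
  assumes "\<And>x. x \<in> S \<Longrightarrow> (f has_derivative f' x) (at x)" "open S"
    and "\<And>v. Ck_on k S (\<lambda>x. f' x v)"
  shows "Ck_on (Suc k) S f"
proof -
  have "f' x v = frechet_derivative f (at x) v" if "x \<in> S" for x v
    using frechet_derivative_at[OF assms(1)[OF that]] by simp
  then have "Ck_on k S (\<lambda>x. frechet_derivative f (at x) v)" for v
    by (rule Ck_on_cong_open[OF assms(2) _ assms(3)[of v]])
  then show ?thesis using assms(1) by (auto simp: differentiable_def)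
qed

lemma Ck_on_SucD: "Ck_on (Suc k) S f \<Longrightarrow> Ck_on k S f"
proof (induction k arbitrary: f)
  case 0
  then show ?case
    by (auto intro!: continuous_at_imp_continuous_on differentiable_imp_continuous_within)
next
  case (Suc k)
  then show ?case by (meson Ck_on.simps(2))
qed

lemma Ck_on_has_derivative:
  "Ck_on (Suc k) S f \<Longrightarrow> x \<in> S \<Longrightarrow> (f has_derivative frechet_derivative f (at x)) (at x)"
  using frechet_derivative_works by auto

lemma Ck_on_const: "open S \<Longrightarrow> Ck_on k S (\<lambda>_. c)"
proof (induction k arbitrary: c)
  case (Suc k)
  show ?case by (rule Ck_on_SucI[where f' = "\<lambda>_ _. 0"]) (use Suc in auto)
qed simp

lemma Ck_on_add:
  "open S \<Longrightarrow> Ck_on k S f \<Longrightarrow> Ck_on k S g \<Longrightarrow> Ck_on k S (\<lambda>x. f x + g x)"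
proof (induction k arbitrary: f g)
  case (Suc k)
  show ?case
    by (rule Ck_on_SucI[where f' = "\<lambda>x v. frechet_derivative f (at x) v + frechet_derivative g (at x) v"])
      (use Suc in \<open>auto intro!: has_derivative_add simp: frechet_derivative_works[symmetric]\<close>)
qed (auto intro: continuous_on_add)

lemma Ck_on_sum:
  assumes "open S" "\<And>i. i \<in> I \<Longrightarrow> Ck_on k S (f i)"
  shows "Ck_on k S (\<lambda>x. \<Sum>i\<in>I. f i x)"
  using assms(2)
  by (induction I rule: infinite_finite_induct) (auto intro: Ck_on_const Ck_on_add assms(1))

text \<open>Each term of the product rule pairs one factor with a derivative of the other. Both are
  of class \<open>Ck_on k\<close>, so the induction hypothesis applies to each term.\<close>

lemma Ck_on_bilinear:
  assumes "bounded_bilinear bil" "open S"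
  shows "Ck_on k S f \<Longrightarrow> Ck_on k S g \<Longrightarrow> Ck_on k S (\<lambda>x. bil (f x) (g x))"
proof (induction k arbitrary: f g)
  case 0
  then show ?case using bounded_bilinear.continuous_on[OF assms(1)] by auto
next
  case (Suc k)
  note D = Ck_on_has_derivative[OF Suc.prems(1)] Ck_on_has_derivative[OF Suc.prems(2)]
  show ?case
  proof (rule Ck_on_SucI[OF bounded_bilinear.FDERIV[OF assms(1) D] assms(2)])
    fix v
    have "Ck_on k S (\<lambda>x. frechet_derivative f (at x) v)" "Ck_on k S (\<lambda>x. frechet_derivative g (at x) v)"
      using Suc.prems by auto
    then show "Ck_on k S (\<lambda>x. bil (f x) (frechet_derivative g (at x) v)
        + bil (frechet_derivative f (at x) v) (g x))"
      by (intro Ck_on_add[OF assms(2)] Suc.IH Ck_on_SucD[OF Suc.prems(1)] Ck_on_SucD[OF Suc.prems(2)])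
  qed
qed

lemma Ck_on_ident: "open S \<Longrightarrow> Ck_on k S (\<lambda>x. x)"
proof (cases k)
  case (Suc m)
  then show "open S \<Longrightarrow> Ck_on k S (\<lambda>x. x)"
    using Ck_on_SucI[of S "\<lambda>x. x" "\<lambda>_ v. v" m] Ck_on_const by fastforce
qed simp

text \<open>The difference of the two sides is orthogonal to every \<open>b\<close>, hence to the
  whole space and to itself. A zero vector in \<open>B\<close> is harmless, as its coefficient is a
  quotient by 0 and thus 0.\<close>

lemma orthogonal_expansion:
  fixes B :: "'e::real_inner set"
  assumes "finite B" "span B = UNIV" "pairwise orthogonal B"
  shows "x = (\<Sum>b\<in>B. ((x \<bullet> b) / (b \<bullet> b)) *\<^sub>R b)"
proof -
  define y where "y = x - (\<Sum>b\<in>B. ((x \<bullet> b) / (b \<bullet> b)) *\<^sub>R b)"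
  have "orthogonal y b" if "b \<in> B" for b
  proof -
    have "(\<Sum>c\<in>B. ((x \<bullet> c) / (c \<bullet> c)) * (c \<bullet> b)) = (\<Sum>c\<in>B. if c = b then x \<bullet> b else 0)"
      using assms(3) that by (intro sum.cong) (auto simp: pairwise_def orthogonal_def)
    then show ?thesis
      using assms(1) that by (simp add: y_def orthogonal_def inner_diff_left inner_sum_left)
  qed
  then have "orthogonal y y"
    using orthogonal_to_span[of y B y] assms(2) by simp
  then show ?thesis by (simp add: y_def orthogonal_def)
qed

lemma ex_orthogonal_basis:
  fixes B :: "'e::real_inner set"
  assumes "finite B" "span B = UNIV"
  obtains C :: "'e set" where "finite C" "span C = UNIV" "pairwise orthogonal C"
  using basis_orthogonal[OF assms(1)] assms(2) by metis

text \<open>The induction hypothesis covers \<open>Df (g x)\<close> in a fixed direction only, while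
  the chain rule evaluates it in the moving direction \<open>Dg x v\<close>. Expanding that
  direction in an orthogonal basis of the middle space gives a finite sum \<open>F\<close> of
  products of \<open>Ck_on k\<close> maps.\<close>

lemma Ck_on_compose:
  fixes g :: "'d::real_normed_vector \<Rightarrow> 'e::real_inner" and B :: "'e set"
  assumes "finite B" "span B = UNIV"
    and "open S" "open T" "g ` S \<subseteq> T"
  shows "Ck_on k T f \<Longrightarrow> Ck_on k S g \<Longrightarrow> Ck_on k S (\<lambda>x. f (g x))"
proof (induction k arbitrary: f)
  case 0
  then show ?case using continuous_on_compose2 assms(5) by (metis Ck_on.simps(1))
next
  case (Suc k)
  obtain C :: "'e set" where C: "finite C" "span C = UNIV" "pairwise orthogonal C"
    using ex_orthogonal_basis[OF assms(1,2)] .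
  let ?Df = "\<lambda>y. frechet_derivative f (at y)" and ?Dg = "\<lambda>x. frechet_derivative g (at x)"
  define F where "F = (\<lambda>x v. \<Sum>b\<in>C. ((?Dg x v \<bullet> b) / (b \<bullet> b)) *\<^sub>R ?Df (g x) b)"
  show ?case
  proof (rule Ck_on_SucI[OF _ assms(3)])
    fix x assume x: "x \<in> S"
    have f: "(f has_derivative ?Df (g x)) (at (g x))"
      using Ck_on_has_derivative[OF Suc.prems(1)] assms(5) x by auto
    interpret linear "?Df (g x)"
      using f by (rule has_derivative_linear)
    have "?Df (g x) (?Dg x v) = F x v" for v
      unfolding F_def by (subst orthogonal_expansion[OF C, of "?Dg x v"]) (simp add: sum scaleR)
    moreover have "((\<lambda>x. f (g x)) has_derivative (\<lambda>v. ?Df (g x) (?Dg x v))) (at x)"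
      by (rule has_derivative_compose[OF Ck_on_has_derivative[OF Suc.prems(2) x] f])
    ultimately show "((\<lambda>x. f (g x)) has_derivative F x) (at x)" by simp
  next
    fix v
    have a: "Ck_on k S (\<lambda>x. ?Df (g x) b)" for b
      using Suc.prems(1) by (intro Suc.IH[of "\<lambda>y. ?Df y b"] Ck_on_SucD[OF Suc.prems(2)]) simp
    have "Ck_on k S (\<lambda>x. ?Dg x v)"
      using Suc.prems(2) by simp
    then have b: "Ck_on k S (\<lambda>x. (?Dg x v \<bullet> b) / (b \<bullet> b))" for b
      unfolding divide_inverse
      by (intro Ck_on_bilinear[OF bounded_bilinear_mult] Ck_on_bilinear[OF bounded_bilinear_inner]
          Ck_on_const assms(3))
    show "Ck_on k S (\<lambda>x. F x v)"
      unfolding F_def by (intro Ck_on_sum Ck_on_bilinear[OF bounded_bilinear_scaleR] assms(3) a b)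
  qed
qed

section \<open>Bump functions\<close>

text \<open>The functions \<open>exp (-1/t) / t\<^sup>n\<close>, extended by 0 to \<open>t \<le> 0\<close>, form a family whose linear span is
  closed under differentiation; hence all of them are smooth.\<close>

definition flat_exp :: "nat \<Rightarrow> real \<Rightarrow> real" where
  "flat_exp n t = (if t > 0 then exp (- (1 / t)) / t ^ n else 0)"

lemma flat_exp_tendsto_0: "(flat_exp n \<longlongrightarrow> 0) (at 0)"
proof -
  have "((\<lambda>t::real. exp (- (1 / t)) / t ^ n) \<longlongrightarrow> 0) (at_right 0)"
    by real_asymp
  then have "(flat_exp n \<longlongrightarrow> 0) (at_right 0)"
    by (rule Lim_transform_eventually)
      (auto simp: flat_exp_def eventually_at_filter)
  moreover have "(flat_exp n \<longlongrightarrow> 0) (at_left 0)"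
    by (rule tendsto_eventually) (auto simp: flat_exp_def eventually_at_filter)
  ultimately show ?thesis by (simp add: filterlim_split_at)
qed

lemma flat_exp_has_derivative:
  "(flat_exp n has_real_derivative flat_exp (n + 2) t - n * flat_exp (n + 1) t) (at t)"
proof -
  consider "t > 0" | "t < 0" | "t = 0" by linarith
  then show ?thesis
  proof cases
    case 1
    have "((\<lambda>t. exp (- (1 / t)) / t ^ n) has_real_derivative
        flat_exp (n + 2) t - n * flat_exp (n + 1) t) (at t)"
      using 1 power_eq_if[of t "n - 1"] by (cases n)
        (auto intro!: derivative_eq_intros simp: flat_exp_def field_simps power2_eq_square)
    then show ?thesis
      by (rule has_field_derivative_transform_within_open[of _ _ _ "{0<..}"])
        (use 1 in \<open>auto simp: flat_exp_def\<close>)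
  next
    case 2
    have "((\<lambda>_. 0) has_real_derivative flat_exp (n + 2) t - n * flat_exp (n + 1) t) (at t)"
      using 2 by (auto simp: flat_exp_def)
    then show ?thesis
      by (rule has_field_derivative_transform_within_open[of _ _ _ "{..<0}"])
        (use 2 in \<open>auto simp: flat_exp_def\<close>)
  next
    case 3
    \<comment> \<open>Since \<open>flat_exp n 0 = 0\<close>, the difference quotient at 0 is
      \<open>flat_exp (Suc n)\<close>, which tends to 0.\<close>
    have "((\<lambda>t. (flat_exp n t - flat_exp n 0) / (t - 0)) \<longlongrightarrow> 0) (at 0)"
      by (rule Lim_transform_eventually[OF flat_exp_tendsto_0[of "Suc n"]])
        (auto simp: flat_exp_def eventually_at_filter)
    then show ?thesis using 3 by (simp add: has_field_derivative_iff flat_exp_def)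
  qed
qed

lemma Ck_on_flat_exp: "Ck_on k UNIV (flat_exp n)"
proof (induction k arbitrary: n)
  case 0
  show ?case
    using flat_exp_has_derivative by (auto intro!: continuous_at_imp_continuous_on DERIV_isCont)
next
  case (Suc k)
  \<comment> \<open>The difference is written as a sum with factor \<open>- real n\<close> to match
    the closure rules for sums and products.\<close>
  have D: "(flat_exp n has_derivative (\<lambda>v. (flat_exp (n + 2) t + (- real n) * flat_exp (n + 1) t) * v)) (at t)"
    for t
    using flat_exp_has_derivative[of n t] by (simp add: has_field_derivative_def)
  show ?case
    by (rule Ck_on_SucI[OF D])
      (intro Ck_on_bilinear[OF bounded_bilinear_mult] Ck_on_add Ck_on_const Suc.IH open_UNIV)+
qed

lemma ex_bump_function:
  fixes x\<^sub>0 :: "'e::real_inner"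
  assumes "r > 0"
  obtains \<psi> where "\<psi> x\<^sub>0 = (1::real)" "\<And>x. x \<notin> cball x\<^sub>0 r \<Longrightarrow> \<psi> x = 0" "\<And>k. Ck_on k UNIV \<psi>"
proof -
  \<comment> \<open>Inside the ball this is \<open>exp (- 1 / t)\<close> with \<open>t\<close> the
    difference of the squared radius and the squared distance to the center; outside it is 0.
    Division by the value at the center normalizes it.\<close>
  define \<phi> where "\<phi> x = flat_exp 0 (r\<^sup>2 + (- 1) * ((x + - x\<^sub>0) \<bullet> (x + - x\<^sub>0)))" for x
  have pos: "\<phi> x\<^sub>0 > 0" using assms by (simp add: \<phi>_def flat_exp_def)
  have 1: "inverse (\<phi> x\<^sub>0) * \<phi> x\<^sub>0 = 1" using pos by simp
  have 2: "inverse (\<phi> x\<^sub>0) * \<phi> x = 0" if "x \<notin> cball x\<^sub>0 r" for x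
  proof -
    have "r \<le> norm (x - x\<^sub>0)" using that by (simp add: dist_norm norm_minus_commute)
    then have "r\<^sup>2 \<le> (x - x\<^sub>0) \<bullet> (x - x\<^sub>0)"
      using assms by (metis dot_square_norm less_imp_le power_mono)
    then show ?thesis by (simp add: \<phi>_def flat_exp_def)
  qed
  have "Ck_on k UNIV \<phi>" for k
    unfolding \<phi>_def
  \<comment> \<open>The middle space of the composition is the real line, spanned by 1.\<close>
  proof (rule Ck_on_compose[of "{1::real}", OF _ _ _ _ _ Ck_on_flat_exp])
    show "span {1::real} = UNIV"
      by (auto simp: span_singleton)
  qed (simp, rule open_UNIV, rule open_UNIV, simp, intro Ck_on_add Ck_on_const
      Ck_on_bilinear[OF bounded_bilinear_mult] Ck_on_bilinear[OF bounded_bilinear_inner]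
      Ck_on_ident open_UNIV)
  then have "Ck_on k UNIV (\<lambda>x. inverse (\<phi> x\<^sub>0) * \<phi> x)" for k
    by (intro Ck_on_bilinear[OF bounded_bilinear_mult] Ck_on_const open_UNIV)
  with 1 2 show ?thesis by (rule that)
qed

section \<open>Finite-dimensional inner product spaces\<close>

text \<open>Coefficients in an orthogonal basis are bounded on the ball, so the ball is a closed
  subset of a compact box.\<close>

lemma compact_cball_finite_dim:
  fixes B :: "'e::real_inner set"
  assumes "finite B" "span B = UNIV"
  shows "compact (cball (x::'e) r)"
proof -
  obtain C :: "'e set" where C: "finite C" "span C = UNIV" "pairwise orthogonal C"
    using ex_orthogonal_basis[OF assms] .
  \<comment> \<open>Induction on the basis: each new vector adds a compact segment, and sums of
    compact sets are compact.\<close>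
  have bd: "\<exists>K. compact K \<and> (\<forall>t. (\<forall>b\<in>C. \<bar>t b\<bar> \<le> R b) \<longrightarrow> (\<Sum>b\<in>C. t b *\<^sub>R b) \<in> K)" for R :: "'e \<Rightarrow> real"
    using C(1)
  proof (induction C)
    case empty
    show ?case by (intro exI[of _ "{0}"]) auto
  next
    case (insert a C)
    then obtain K where K: "compact K" "\<And>t. (\<forall>b\<in>C. \<bar>t b\<bar> \<le> R b) \<Longrightarrow> (\<Sum>b\<in>C. t b *\<^sub>R b) \<in> K" by blast
    have "compact ((\<lambda>s. s *\<^sub>R a) ` {- R a..R a})"
      by (intro compact_continuous_image continuous_intros) auto
    then have "compact {y + z |y z. y \<in> (\<lambda>s. s *\<^sub>R a) ` {- R a..R a} \<and> z \<in> K}"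
      using K(1) by (rule compact_sums)
    then show ?case
      using insert K(2)
      by (intro exI[of _ "{y + z |y z. y \<in> (\<lambda>s. s *\<^sub>R a) ` {- R a..R a} \<and> z \<in> K}"]) fastforce
  qed
  \<comment> \<open>The coefficient bound is Cauchy-Schwarz for a vector of norm at most
    \<open>norm x + \<bar>r\<bar>\<close>; the absolute value covers negative
    \<open>r\<close>.\<close>
  obtain K where K: "compact K"
    "\<And>t. (\<forall>b\<in>C. \<bar>t b\<bar> \<le> (norm x + \<bar>r\<bar>) * norm b / (b \<bullet> b)) \<Longrightarrow> (\<Sum>b\<in>C. t b *\<^sub>R b) \<in> K"
    using bd[of "\<lambda>b. (norm x + \<bar>r\<bar>) * norm b / (b \<bullet> b)"] by (elim exE conjE) simp
  have "cball x r \<subseteq> K"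
  proof
    fix y assume "y \<in> cball x r"
    then have "norm (y - x) \<le> \<bar>r\<bar>" by (simp add: dist_norm norm_minus_commute)
    then have ny: "norm y \<le> norm x + \<bar>r\<bar>" by norm
    have "\<bar>(y \<bullet> b) / (b \<bullet> b)\<bar> \<le> (norm x + \<bar>r\<bar>) * norm b / (b \<bullet> b)" for b
    proof -
      have "\<bar>y \<bullet> b\<bar> \<le> (norm x + \<bar>r\<bar>) * norm b"
        using Cauchy_Schwarz_ineq2[of y b] mult_right_mono[OF ny norm_ge_zero[of b]] by linarith
      then show ?thesis by (simp add: divide_right_mono)
    qed
    then show "y \<in> K"
      using K(2)[of "\<lambda>b. (y \<bullet> b) / (b \<bullet> b)"] orthogonal_expansion[OF C, of y] by simp
  qed
  then have "cball x r = K \<inter> cball x r" by blast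
  then show ?thesis using compact_Int_closed[OF K(1) closed_cball] by metis
qed

text \<open>Representing functionals by vectors turns \<open>\<beta>\<close> into a linear
  endomorphism of a finite-dimensional space. Non-degeneracy makes it injective, hence
  surjective.\<close>

lemma nondegenerate_bilinear_surj:
  fixes \<beta> :: "'e::real_inner \<Rightarrow> 'e \<Rightarrow> real" and B :: "'e set"
  assumes "finite B" "span B = UNIV"
    and lin: "\<And>w. linear (\<lambda>u. \<beta> u w)" "\<And>u. linear (\<beta> u)" and \<alpha>: "linear \<alpha>"
    and nd: "\<And>u. (\<forall>w. \<beta> u w = 0) \<Longrightarrow> u = 0"
  shows "\<exists>u. \<forall>w. \<beta> u w = \<alpha> w"
proof -
  obtain C :: "'e set" where C: "finite C" "span C = UNIV" "pairwise orthogonal C"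
    using ex_orthogonal_basis[OF assms(1,2)] .
  \<comment> \<open>the vector representing a functional with respect to the inner product\<close>
  define rep where "rep f = (\<Sum>b\<in>C. (f b / (b \<bullet> b)) *\<^sub>R b)" for f :: "'e \<Rightarrow> real"
  have rep: "rep f \<bullet> w = f w" if "linear f" for f w
  proof -
    have "f w = f (\<Sum>b\<in>C. ((w \<bullet> b) / (b \<bullet> b)) *\<^sub>R b)"
      using orthogonal_expansion[OF C, of w] by simp
    also have "\<dots> = rep f \<bullet> w"
      by (simp add: rep_def linear_sum[OF that] linear_scale[OF that] inner_sum_left
          inner_commute[of w] mult.commute)
    finally show ?thesis by simp
  qed
  have linG: "linear (\<lambda>u. rep (\<beta> u))"
    unfolding rep_def
    by (rule linearI) (simp_all add: linear_add[OF lin(1)] linear_scale[OF lin(1)] add_divide_distrib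
        scaleR_add_left sum.distrib scaleR_sum_right)
  have "inj (\<lambda>u. rep (\<beta> u))"
    unfolding linear_injective_0[OF linG]
  proof (intro allI impI)
    fix u assume "rep (\<beta> u) = 0"
    then have "\<beta> u w = 0" for w using rep[OF lin(2)[of u], of w] by simp
    then show "u = 0" using nd by blast
  qed
  \<comment> \<open>The orthogonal set \<open>C\<close> may contain 0, so an independent subset is
    extracted to serve as a basis.\<close>
  obtain D :: "'e set" where D: "D \<subseteq> C" "independent D" "C \<subseteq> span D"
    using maximal_independent_subset[of C] by blast
  have fD: "finite D" "span D = UNIV"
    using D C finite_subset span_mono[OF D(3)] by (auto simp: span_span)
  interpret fd: finite_dimensional_vector_space "scaleR :: real \<Rightarrow> 'e \<Rightarrow> 'e" D
    by unfold_locales (use D fD in \<open>auto simp: dependent_raw_def span_raw_def\<close>)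
  have "surj (\<lambda>u. rep (\<beta> u))"
    by (rule fd.linear_inj_imp_surj[OF linG[unfolded linear_def]]) fact
  then obtain u where "rep \<alpha> = rep (\<beta> u)" by blast
  then have "\<beta> u w = \<alpha> w" for w using rep[OF lin(2), of u w] rep[OF \<alpha>, of w] by simp
  then show ?thesis by blast
qed

section \<open>Tangent vectors in charts\<close>

abbreviation transition_deriv ::
  "('a, 'e::real_normed_vector) chart \<Rightarrow> ('a, 'e) chart \<Rightarrow> 'a \<Rightarrow> 'e \<Rightarrow> 'e" where
  "transition_deriv c d p \<equiv> frechet_derivative (transition c d) (at (snd c p))"

text \<open>Isolates the properties of transition maps behind the algebra of tangent vectors, so
  that the same lemmas serve the atlas of \<open>M\<close> and the induced atlas of
  \<open>TM\<close>.\<close>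

locale differentiable_atlas =
  fixes A :: "('a, 'e::real_normed_vector) chart set"
  assumes inj_chart: "c \<in> A \<Longrightarrow> inj_on (snd c) (fst c)"
    and open_overlap: "c \<in> A \<Longrightarrow> d \<in> A \<Longrightarrow> open (snd c ` (fst c \<inter> fst d))"
    and differentiable_transition: "c \<in> A \<Longrightarrow> d \<in> A \<Longrightarrow> p \<in> fst c \<Longrightarrow> p \<in> fst d \<Longrightarrow>
      transition c d differentiable (at (snd c p))"
begin

lemma transition_apply: "c \<in> A \<Longrightarrow> p \<in> fst c \<Longrightarrow> transition c d (snd c p) = snd d p"
  by (simp add: transition_def inj_chart)

lemma has_derivative_transition:
  "c \<in> A \<Longrightarrow> d \<in> A \<Longrightarrow> p \<in> fst c \<Longrightarrow> p \<in> fst d \<Longrightarrow>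
    (transition c d has_derivative transition_deriv c d p) (at (snd c p))"
  using differentiable_transition unfolding frechet_derivative_works by this

lemma linear_transition_deriv:
  "c \<in> A \<Longrightarrow> d \<in> A \<Longrightarrow> p \<in> fst c \<Longrightarrow> p \<in> fst d \<Longrightarrow> linear (transition_deriv c d p)"
  by (rule has_derivative_linear[OF has_derivative_transition])

text \<open>Chain rule for the composite of two transition maps, which agrees with the direct one on
  the overlap of \<open>c\<close> and \<open>d\<close>, an open set around \<open>snd c p\<close>.
  It makes the components in \<open>tangent_of\<close> compatible.\<close>

lemma transition_deriv_compose:
  assumes "c \<in> A" "d \<in> A" "e \<in> A" "p \<in> fst c" "p \<in> fst d" "p \<in> fst e"
  shows "transition_deriv d e p (transition_deriv c d p w) = transition_deriv c e p w"
proof -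
  have d: "(transition d e has_derivative transition_deriv d e p) (at (transition c d (snd c p)))"
    using has_derivative_transition[of d e p] assms transition_apply[of c p d] by simp
  have "((\<lambda>x. transition d e (transition c d x)) has_derivative
      (\<lambda>w. transition_deriv d e p (transition_deriv c d p w))) (at (snd c p))"
    by (rule has_derivative_compose[OF has_derivative_transition d]) (use assms in auto)
  then have "(transition c e has_derivative (\<lambda>w. transition_deriv d e p (transition_deriv c d p w))) (at (snd c p))"
    by (rule has_derivative_transform_within_open[OF _ open_overlap[of c d]])
      (use assms in \<open>auto simp: transition_apply\<close>)
  from fun_cong[OF frechet_derivative_at[OF this], of w] show ?thesis by simp
qed

lemma transition_deriv_self:
  assumes "c \<in> A" "p \<in> fst c"
  shows "transition_deriv c c p w = w"
proof -
  have "((\<lambda>x. x) has_derivative (\<lambda>w. w)) (at (snd c p))" by simp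
  then have "(transition c c has_derivative (\<lambda>w. w)) (at (snd c p))"
    by (rule has_derivative_transform_within_open[OF _ open_overlap[of c c]])
      (use assms in \<open>auto simp: transition_apply\<close>)
  from fun_cong[OF frechet_derivative_at[OF this], of w] show ?thesis by simp
qed

lemma tangent_spaceI:
  assumes "\<And>c. \<not> (c \<in> A \<and> p \<in> fst c) \<Longrightarrow> v c = 0"
    and "\<And>c d. c \<in> A \<Longrightarrow> d \<in> A \<Longrightarrow> p \<in> fst c \<Longrightarrow> p \<in> fst d \<Longrightarrow> v d = transition_deriv c d p (v c)"
  shows "v \<in> tangent_space A p"
  unfolding tangent_space_def mem_Collect_eq using assms by (intro conjI ballI allI impI) blast+

lemma tangent_space_outside: "v \<in> tangent_space A p \<Longrightarrow> \<not> (c \<in> A \<and> p \<in> fst c) \<Longrightarrow> v c = 0"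
  unfolding tangent_space_def by blast

lemma tangent_space_transition:
  "v \<in> tangent_space A p \<Longrightarrow> c \<in> A \<Longrightarrow> d \<in> A \<Longrightarrow> p \<in> fst c \<Longrightarrow> p \<in> fst d \<Longrightarrow>
    v d = transition_deriv c d p (v c)"
  unfolding tangent_space_def by blast

lemma tangent_of_in_tangent_space:
  assumes "c \<in> A" "p \<in> fst c"
  shows "tangent_of A c p w \<in> tangent_space A p"
  using assms by (intro tangent_spaceI) (auto simp: tangent_of_def transition_deriv_compose)

lemma tangent_of_self: "c \<in> A \<Longrightarrow> p \<in> fst c \<Longrightarrow> tangent_of A c p w c = w"
  by (simp add: tangent_of_def transition_deriv_self)

lemma tangent_space_eqI:
  assumes "u \<in> tangent_space A p" "v \<in> tangent_space A p" "c \<in> A" "p \<in> fst c" "u c = v c"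
  shows "u = v"
proof
  show "u d = v d" for d
    using assms tangent_space_outside tangent_space_transition[of _ p c d]
    by (cases "d \<in> A \<and> p \<in> fst d") metis+
qed

lemma zero_in_tangent_space: "(\<lambda>_. 0) \<in> tangent_space A p"
  by (intro tangent_spaceI) (simp_all add: linear_0[OF linear_transition_deriv])

lemma vadd_in_tangent_space:
  assumes "u \<in> tangent_space A p" "v \<in> tangent_space A p"
  shows "vadd u v \<in> tangent_space A p"
proof (rule tangent_spaceI)
  show "vadd u v c = 0" if "\<not> (c \<in> A \<and> p \<in> fst c)" for c
    using assms[THEN tangent_space_outside, OF that] by (simp add: vadd_def)
  show "vadd u v d = transition_deriv c d p (vadd u v c)"
    if "c \<in> A" "d \<in> A" "p \<in> fst c" "p \<in> fst d" for c d
    unfolding vadd_def linear_add[OF linear_transition_deriv[OF that]]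
    using assms[THEN tangent_space_transition, OF that] by (rule arg_cong2)
qed

lemma tangent_of_components:
  "u \<in> tangent_space A p \<Longrightarrow> c \<in> A \<Longrightarrow> p \<in> fst c \<Longrightarrow> tangent_of A c p (u c) = u"
  by (rule tangent_space_eqI[of _ p _ c]) (auto simp: tangent_of_in_tangent_space tangent_of_self)

lemma tangent_of_add:
  assumes "c \<in> A" "p \<in> fst c"
  shows "tangent_of A c p (v + w) = vadd (tangent_of A c p v) (tangent_of A c p w)"
  using assms by (simp add: fun_eq_iff tangent_of_def vadd_def linear_add[OF linear_transition_deriv])

lemma tangent_of_scale:
  assumes "c \<in> A" "p \<in> fst c"
  shows "tangent_of A c p (r *\<^sub>R w) = vscale r (tangent_of A c p w)"
  using assms by (simp add: fun_eq_iff tangent_of_def vscale_def linear_scale[OF linear_transition_deriv])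

text \<open>Moves covectors to the model space, where linear algebra applies; tangent vectors
  themselves carry only \<open>vadd\<close> and \<open>vscale\<close>.\<close>

lemma linear_cotangent:
  assumes "\<alpha> \<in> cotangent_space A p" "c \<in> A" "p \<in> fst c"
  shows "linear (\<lambda>w. \<alpha> (tangent_of A c p w))"
  using assms tangent_of_in_tangent_space
  by (intro linearI) (simp_all add: tangent_of_add tangent_of_scale cotangent_space_def)

end

section \<open>Charts of a smooth manifold\<close>

lemma smooth_manifold_finite_dim:
  fixes A :: "('a, 'e::real_inner) chart set"
  assumes "smooth_manifold M A"
  obtains B :: "'e set" where "finite B" "span B = UNIV"
  using assms unfolding smooth_manifold_def by blast

lemma smooth_manifold_chart:
  assumes "smooth_manifold M A" "c \<in> A"
  shows "openin M (fst c)" "open (chart_image c)"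
    "homeomorphic_map (subtopology M (fst c)) (top_of_set (chart_image c)) (snd c)"
  using assms unfolding smooth_manifold_def by blast+

lemma smooth_manifold_transition:
  assumes "smooth_manifold M A" "c \<in> A" "d \<in> A"
  shows "Ck_on k (snd c ` (fst c \<inter> fst d)) (transition c d)"
  using assms unfolding smooth_manifold_def smooth_on_def by blast

lemma smooth_manifold_open_image:
  assumes "smooth_manifold M A" "c \<in> A" "openin M U"
  shows "open (snd c ` (fst c \<inter> U))"
proof -
  note c = smooth_manifold_chart[OF assms(1,2)]
  have "openin (subtopology M (fst c)) (fst c \<inter> U)"
    using assms(3) by (auto simp: openin_subtopology)
  then have "openin (top_of_set (chart_image c)) (snd c ` (fst c \<inter> U))"
    using homeomorphic_imp_open_map[OF c(3)] by (auto simp: open_map_def)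
  then show ?thesis using c(2) openin_open_eq by blast
qed

lemma smooth_manifold_inj:
  assumes "smooth_manifold M A" "c \<in> A"
  shows "inj_on (snd c) (fst c)"
proof -
  note c = smooth_manifold_chart[OF assms]
  have "topspace (subtopology M (fst c)) = fst c"
    using openin_subset[OF c(1)] by auto
  then show ?thesis using homeomorphic_imp_injective_map[OF c(3)] by simp
qed

lemma smooth_manifold_differentiable_atlas:
  assumes "smooth_manifold M A"
  shows "differentiable_atlas A"
proof
  fix c d p
  assume *: "c \<in> A" "d \<in> A"
  show "inj_on (snd c) (fst c)" by (rule smooth_manifold_inj[OF assms *(1)])
  show "open (snd c ` (fst c \<inter> fst d))"
    by (rule smooth_manifold_open_image[OF assms *(1) smooth_manifold_chart(1)[OF assms *(2)]])
  assume "p \<in> fst c" "p \<in> fst d"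
  then show "transition c d differentiable (at (snd c p))"
    using smooth_manifold_transition[OF assms *, of "Suc 0"] by auto
qed

section \<open>The induced charts of the tangent bundle\<close>

lemma tangent_chart_overlap_image:
  assumes "differentiable_atlas A" "c \<in> A" "d \<in> A"
  shows "snd (tangent_chart A c) ` (fst (tangent_chart A c) \<inter> fst (tangent_chart A d)) =
    snd c ` (fst c \<inter> fst d) \<times> UNIV" (is "?L = ?R")
proof
  interpret differentiable_atlas A by fact
  show "?L \<subseteq> ?R" by (auto simp: tangent_chart_def)
  show "?R \<subseteq> ?L"
  proof clarsimp
    fix p y assume p: "p \<in> fst c" "p \<in> fst d"
    show "(snd c p, y) \<in> ?L"
      by (rule image_eqI[of _ _ "(p, tangent_of A c p y)"])
        (use p assms tangent_of_in_tangent_space tangent_of_self in \<open>auto simp: tangent_chart_def\<close>)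
  qed
qed

lemma inj_tangent_chart:
  assumes "differentiable_atlas A" "c \<in> A"
  shows "inj_on (snd (tangent_chart A c)) (fst (tangent_chart A c))"
proof -
  interpret differentiable_atlas A by fact
  show ?thesis
  proof (rule inj_onI, unfold tangent_chart_def, clarsimp)
    fix p v q w
    assume *: "p \<in> fst c" "v \<in> tangent_space A p" "q \<in> fst c" "w \<in> tangent_space A q"
      "snd c p = snd c q" "v c = w c"
    then have "p = q" using inj_chart[OF assms(2)] by (simp add: inj_on_def)
    with * show "p = q \<and> v = w" using tangent_space_eqI[of v p w c] assms(2) by simp
  qed
qed

text \<open>The point with coordinates \<open>(x, y)\<close> is
  \<open>(p, tangent_of A c p y)\<close>, and the component of this vector in \<open>d\<close> is by
  definition the Jacobian applied to \<open>y\<close>.\<close>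

lemma tangent_chart_transition:
  assumes "differentiable_atlas A" "c \<in> A" "d \<in> A" "x \<in> snd c ` (fst c \<inter> fst d)"
  shows "transition (tangent_chart A c) (tangent_chart A d) (x, y) =
    (transition c d x, frechet_derivative (transition c d) (at x) y)"
proof -
  interpret differentiable_atlas A by fact
  obtain p where p: "x = snd c p" "p \<in> fst c" "p \<in> fst d" using assms(4) by blast
  let ?a = "(p, tangent_of A c p y)"
  have a: "?a \<in> fst (tangent_chart A c)" "snd (tangent_chart A c) ?a = (x, y)"
    using p assms(2) tangent_of_in_tangent_space tangent_of_self by (auto simp: tangent_chart_def)
  have "chart_inv (tangent_chart A c) (snd (tangent_chart A c) ?a) = ?a"
    by (rule inv_into_f_f[OF inj_tangent_chart[OF assms(1,2)] a(1)])
  then have "chart_inv (tangent_chart A c) (x, y) = ?a"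
    using a(2) by simp
  then show ?thesis
    using p assms(2,3) transition_apply[of c p d]
    by (simp add: transition_def[of "tangent_chart A c"]) (simp add: tangent_chart_def tangent_of_def)
qed

lemma tangent_atlas_differentiable_atlas:
  fixes A :: "('a, 'e::real_inner) chart set"
  assumes "smooth_manifold M A"
  shows "differentiable_atlas (tangent_atlas A)"
proof -
  interpret differentiable_atlas A using assms by (rule smooth_manifold_differentiable_atlas)
  obtain B :: "'e set" where "finite B" "span B = UNIV" using smooth_manifold_finite_dim[OF assms] .
  then obtain C :: "'e set" where C: "finite C" "span C = UNIV" "pairwise orthogonal C"
    using ex_orthogonal_basis by metis
  show ?thesis
  proof
    fix tc td a assume "tc \<in> tangent_atlas A" "td \<in> tangent_atlas A"
    then obtain c d where cd: "c \<in> A" "d \<in> A" "tc = tangent_chart A c" "td = tangent_chart A d"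
      by (auto simp: tangent_atlas_def)
    show "inj_on (snd tc) (fst tc)"
      using inj_tangent_chart[OF differentiable_atlas_axioms] cd by simp
    show o: "open (snd tc ` (fst tc \<inter> fst td))"
      using tangent_chart_overlap_image[OF differentiable_atlas_axioms] open_overlap cd
      by (simp add: open_Times)
    assume a: "a \<in> fst tc" "a \<in> fst td"
    obtain p v where pv: "a = (p, v)" "p \<in> fst c" "p \<in> fst d"
      using a cd by (auto simp: tangent_chart_def)
    let ?J = "\<lambda>x. frechet_derivative (transition c d) (at x)"
    \<comment> \<open>Expanding the fibre coordinate in a basis leaves the Jacobian in fixed
      directions only, so joint differentiability in \<open>(x, y)\<close> reduces to
      differentiability in \<open>x\<close>.\<close>
    define F where "F z = (transition c d (fst z),
      \<Sum>b\<in>C. ((snd z \<bullet> b) / (b \<bullet> b)) *\<^sub>R ?J (fst z) b)" for z :: "'e \<times> 'e"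
    have F: "transition tc td z = F z" if z: "z \<in> snd tc ` (fst tc \<inter> fst td)" for z
    proof -
      obtain x y where xy: "z = (x, y)" by fastforce
      then have x: "x \<in> snd c ` (fst c \<inter> fst d)"
        using z tangent_chart_overlap_image[OF differentiable_atlas_axioms cd(1,2)] cd by auto
      then have "linear (?J x)" using cd(1,2) by (auto intro: linear_transition_deriv)
      then have "?J x y = (\<Sum>b\<in>C. ((y \<bullet> b) / (b \<bullet> b)) *\<^sub>R ?J x b)"
        by (subst orthogonal_expansion[OF C, of y]) (simp add: linear_sum linear_scale)
      then show ?thesis
        using tangent_chart_transition[OF differentiable_atlas_axioms cd(1,2) x, of y] xy cd
        by (simp add: F_def)
    qed
    have sz: "snd tc a = (snd c p, v c)" using pv cd by (simp add: tangent_chart_def)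
    \<comment> \<open>Differentiating the Jacobian takes two orders of smoothness of the transition
      map.\<close>
    have J: "(\<lambda>x. ?J x b) differentiable (at (snd c p))" for b
      using smooth_manifold_transition[OF assms cd(1,2), of "Suc (Suc 0)"] pv by auto
    have "F differentiable (at (snd c p, v c))"
    proof -
      have fst: "fst differentiable (at (snd c p, v c))"
        by (intro bounded_linear_imp_differentiable bounded_linear_fst)
      have "(\<lambda>z. ?J (fst z) b) differentiable (at (snd c p, v c))" for b
        by (rule differentiable_compose[OF _ fst]) (simp add: J)
      moreover have "(\<lambda>z. (snd z \<bullet> b) / (b \<bullet> b)) differentiable (at (snd c p, v c))" for b :: 'e
        by (intro bounded_linear_imp_differentiable bounded_linear_compose[OF bounded_linear_divide]
            bounded_linear_inner_left_comp bounded_linear_snd)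
      moreover have "(\<lambda>z. transition c d (fst z)) differentiable (at (snd c p, v c))"
        by (rule differentiable_compose[OF _ fst]) (simp add: differentiable_transition cd pv)
      ultimately show ?thesis
        unfolding F_def by (intro differentiable_Pair differentiable_sum differentiable_scaleR) (simp_all add: C)
    qed
    then obtain D where "(F has_derivative D) (at (snd tc a))"
      unfolding sz differentiable_def by blast
    then have "(transition tc td has_derivative D) (at (snd tc a))"
      by (rule has_derivative_transform_within_open[OF _ o]) (use a F in auto)
    then show "transition tc td differentiable (at (snd tc a))"
      by (auto simp: differentiable_def)
  qed
qed

section \<open>Extension of tangent vectors to vector fields\<close>

text \<open>The preimage is the image of \<open>K\<close> under the inverse homeomorphism, hence
  compact in \<open>M\<close>, and compact subsets of a Hausdorff space are closed.\<close>

lemma smooth_manifold_closedin_preimage_compact: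
  assumes "smooth_manifold M A" "c \<in> A" "compact K" "K \<subseteq> chart_image c"
  shows "closedin M {q \<in> fst c. snd c q \<in> K}"
proof -
  note c = smooth_manifold_chart[OF assms(1,2)]
  have ts: "topspace (subtopology M (fst c)) = fst c"
    using openin_subset[OF c(1)] by auto
  obtain g where g: "homeomorphic_maps (subtopology M (fst c)) (top_of_set (chart_image c)) (snd c) g"
    using c(3) homeomorphic_map_maps by blast
  then have cont: "continuous_map (top_of_set (chart_image c)) (subtopology M (fst c)) g"
    and gf: "\<And>q. q \<in> fst c \<Longrightarrow> g (snd c q) = q"
    and fg: "\<And>x. x \<in> chart_image c \<Longrightarrow> snd c (g x) = x"
    using ts by (auto simp: homeomorphic_maps_def)
  have "compactin (top_of_set (chart_image c)) K"
    using assms(3,4) by (simp add: compactin_subtopology)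
  from image_compactin[OF this cont] have "compactin M (g ` K)"
    by (simp add: compactin_subtopology)
  moreover have "g ` K = {q \<in> fst c. snd c q \<in> K}"
  proof (intro equalityI subsetI)
    fix q assume "q \<in> g ` K"
    then obtain x where x: "x \<in> K" "q = g x" by blast
    then obtain r where "r \<in> fst c" "x = snd c r" using assms(4) by blast
    then show "q \<in> {q \<in> fst c. snd c q \<in> K}" using x gf by simp
  next
    fix q assume "q \<in> {q \<in> fst c. snd c q \<in> K}"
    then show "q \<in> g ` K" using gf by (auto intro!: image_eqI[of q g "snd c q"])
  qed
  moreover have "Hausdorff_space M" using assms(1) by (simp add: smooth_manifold_def)
  ultimately show ?thesis using compactin_imp_closedin by metis
qed

lemma ex_vector_field_at:
  fixes A :: "('a, 'e::real_inner) chart set"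
  assumes M: "smooth_manifold M A" and p: "p \<in> \<Union> (fst ` A)" and u: "u \<in> tangent_space A p"
  obtains X where "vector_field A X" "X p = u"
proof -
  interpret differentiable_atlas A using M by (rule smooth_manifold_differentiable_atlas)
  obtain B :: "'e set" where B: "finite B" "span B = UNIV" using smooth_manifold_finite_dim[OF M] .
  obtain c where c: "c \<in> A" "p \<in> fst c" using p by blast
  note ch = smooth_manifold_chart[OF M c(1)]
  obtain r where r: "r > 0" "cball (snd c p) r \<subseteq> chart_image c"
    using ch(2) c(2) open_contains_cball by blast
  obtain \<psi> :: "'e \<Rightarrow> real" where \<psi>: "\<psi> (snd c p) = 1" "\<And>x. x \<notin> cball (snd c p) r \<Longrightarrow> \<psi> x = 0"
    "\<And>k. Ck_on k UNIV \<psi>"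
    using ex_bump_function[OF r(1), of "snd c p"] by metis
  define X where "X q = (if q \<in> fst c then tangent_of A c q (\<psi> (snd c q) *\<^sub>R u c) else (\<lambda>_. 0))" for q
  define K where "K = {q \<in> fst c. snd c q \<in> cball (snd c p) r}"
  have K: "closedin M K"
    unfolding K_def by (rule smooth_manifold_closedin_preimage_compact[OF M c(1)
        compact_cball_finite_dim[OF B] r(2)])
  have "Ck_on k (chart_image d) (\<lambda>x. X (chart_inv d x) d)" if d: "d \<in> A" for d k
  proof -
    note dh = smooth_manifold_chart[OF M d]
    \<comment> \<open>Smoothness in the chart \<open>d\<close> is checked on two open pieces: the
      overlap with \<open>c\<close>, where an explicit formula holds, and the part outside the
      closed set \<open>K\<close>, where the field vanishes.\<close>
    let ?O = "snd d ` (fst d \<inter> fst c)" and ?N = "snd d ` (fst d \<inter> (topspace M - K))"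
    have sub: "fst d \<subseteq> topspace M" by (rule openin_subset[OF dh(1)])
    have opens: "open ?O" "open ?N"
      using smooth_manifold_open_image[OF M d] ch(1) K by (auto simp: closedin_def)
    have inv: "chart_inv d (snd d q) = q" if "q \<in> fst d" for q
      using inj_chart[OF d] that by simp
    have "Ck_on k ?O (\<lambda>x. \<psi> (transition d c x) *\<^sub>R
        frechet_derivative (transition c d) (at (transition d c x)) (u c))"
    proof (intro Ck_on_bilinear[OF bounded_bilinear_scaleR opens(1)])
      have T: "Ck_on k ?O (transition d c)"
        using smooth_manifold_transition[OF M d c(1)] .
      show "Ck_on k ?O (\<lambda>x. \<psi> (transition d c x))"
        by (rule Ck_on_compose[OF B opens(1) open_UNIV _ \<psi>(3) T]) simp
      \<comment> \<open>The field contains the Jacobian of the transition map, which costs one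
        order; hence \<open>Suc k\<close>.\<close>
      have "Ck_on k (snd c ` (fst c \<inter> fst d)) (\<lambda>x. frechet_derivative (transition c d) (at x) (u c))"
        using smooth_manifold_transition[OF M c(1) d, of "Suc k"] by simp
      moreover have "transition d c ` ?O \<subseteq> snd c ` (fst c \<inter> fst d)"
        using d by (auto simp: transition_apply)
      ultimately show "Ck_on k ?O (\<lambda>x. frechet_derivative (transition c d) (at (transition d c x)) (u c))"
        by (intro Ck_on_compose[OF B opens(1) open_overlap[OF c(1) d] _ _ T])
    qed
    then have O: "Ck_on k ?O (\<lambda>x. X (chart_inv d x) d)"
    proof (rule Ck_on_cong_open[OF opens(1), rotated])
      fix x assume "x \<in> ?O"
      then obtain q where q: "x = snd d q" "q \<in> fst d" "q \<in> fst c" by blast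
      then show "\<psi> (transition d c x) *\<^sub>R
          frechet_derivative (transition c d) (at (transition d c x)) (u c) = X (chart_inv d x) d"
        using d c(1) by (simp add: X_def inv transition_apply tangent_of_def
            linear_scale[OF linear_transition_deriv])
    qed
    have "X (chart_inv d x) d = 0" if x: "x \<in> ?N" for x
    proof -
      obtain q where q: "x = snd d q" "q \<in> fst d" "q \<notin> K" using x by blast
      then show ?thesis
        using \<psi>(2) d c(1) by (auto simp: X_def inv K_def tangent_of_def
            linear_0[OF linear_transition_deriv])
    qed
    then have N: "Ck_on k ?N (\<lambda>x. X (chart_inv d x) d)"
      by (intro Ck_on_cong_open[OF opens(2) _ Ck_on_const[OF opens(2), of _ 0]]) simp
    have "Ck_on k (\<Union>{?O, ?N}) (\<lambda>x. X (chart_inv d x) d)"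
      by (rule Ck_on_Union) (use O N opens in auto)
    \<comment> \<open>A point of \<open>d\<close> outside \<open>c\<close> is not in
      \<open>K\<close>, so it lies in the second piece.\<close>
    moreover have "chart_image d \<subseteq> \<Union>{?O, ?N}" using sub by (auto simp: K_def)
    ultimately show ?thesis by (rule Ck_on_subset)
  qed
  then have "vector_field A X"
    by (auto simp: vector_field_def smooth_on_def X_def zero_in_tangent_space
        tangent_of_in_tangent_space c(1))
  moreover have "X p = u"
    using c u \<psi>(1) by (simp add: X_def tangent_of_components)
  ultimately show ?thesis by (rule that)
qed

section \<open>The inverse of a non-degenerate tensor\<close>

text \<open>The description in \<open>tensor_inv\<close> needs unique existence. In the components
  of one chart, existence is surjectivity of the non-degenerate form and uniqueness is its
  injectivity.\<close>

lemma tensor_inv_works: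
  fixes A :: "('a, 'e::real_inner) chart set"
  assumes M: "smooth_manifold M A" and h: "tensor_field02 A h" "nondegenerate A h"
    and p: "p \<in> \<Union> (fst ` A)" and \<alpha>: "\<alpha> \<in> cotangent_space A p"
  shows "tensor_inv A h p \<alpha> \<in> tangent_space A p"
    and "\<And>w. w \<in> tangent_space A p \<Longrightarrow> h p (tensor_inv A h p \<alpha>) w = \<alpha> w"
proof -
  interpret differentiable_atlas A using M by (rule smooth_manifold_differentiable_atlas)
  obtain B :: "'e set" where B: "finite B" "span B = UNIV" using smooth_manifold_finite_dim[OF M] .
  obtain c where c: "c \<in> A" "p \<in> fst c" using p by blast
  let ?t = "tangent_of A c p"
  have hc: "h p u \<in> cotangent_space A p" "(\<lambda>w. h p w u) \<in> cotangent_space A p"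
    if "u \<in> tangent_space A p" for u
    using h(1) p that unfolding tensor_field02_def by blast+
  note t = tangent_of_in_tangent_space[OF c]
  have nd: "u = 0" if "\<forall>w. h p (?t u) (?t w) = 0" for u
  proof -
    have "\<forall>w\<in>tangent_space A p. h p (?t u) w = 0"
      using that tangent_of_components[OF _ c] by metis
    then have "?t u = (\<lambda>_. 0)"
      using h(2) p t unfolding nondegenerate_def by blast
    then show "u = 0" using tangent_of_self[OF c, of u] by simp
  qed
  have "\<exists>u. \<forall>w. h p (?t u) (?t w) = \<alpha> (?t w)"
    by (rule nondegenerate_bilinear_surj[OF B, of "\<lambda>u w. h p (?t u) (?t w)"])
      (use linear_cotangent[OF hc(1)[OF t] c] linear_cotangent[OF hc(2)[OF t] c]
        linear_cotangent[OF \<alpha> c] nd in blast)+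
  then obtain u\<^sub>0 where u\<^sub>0: "\<And>w. h p (?t u\<^sub>0) (?t w) = \<alpha> (?t w)" by blast
  let ?P = "\<lambda>u. u \<in> tangent_space A p \<and> (\<forall>w\<in>tangent_space A p. h p u w = \<alpha> w)"
  have "\<exists>!u. ?P u"
  proof (rule ex1I[of _ "?t u\<^sub>0"])
    show P0: "?P (?t u\<^sub>0)"
      using t u\<^sub>0 tangent_of_components[OF _ c] by metis
    fix u assume u: "?P u"
    have "h p (?t (u c - u\<^sub>0)) (?t w) = 0" for w
    proof -
      have "h p (?t (u c)) (?t w) = h p (?t u\<^sub>0) (?t w)"
        using u P0 t tangent_of_components[OF _ c] by metis
      then show ?thesis
        using linear_diff[OF linear_cotangent[OF hc(2)[OF t] c]] by simp
    qed
    then have "u c = u\<^sub>0" using nd[of "u c - u\<^sub>0"] by simp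
    then show "u = ?t u\<^sub>0" using u tangent_of_components[OF _ c] by metis
  qed
  then have "?P (tensor_inv A h p \<alpha>)"
    unfolding tensor_inv_def by (rule theI')
  then show "tensor_inv A h p \<alpha> \<in> tangent_space A p"
    and "\<And>w. w \<in> tangent_space A p \<Longrightarrow> h p (tensor_inv A h p \<alpha>) w = \<alpha> w" by auto
qed

section \<open>The pull-back of the horizontal lift\<close>

lemma tangent_bundle_base: "a \<in> tangent_bundle A \<Longrightarrow> fst a \<in> \<Union> (fst ` A)"
  unfolding tangent_bundle_def by (erule SigmaE) simp

lemma lifts_in_tangent_space:
  assumes "differentiable_atlas (tangent_atlas A)" "a \<in> tangent_bundle A"
  shows "hlift A nabla u a \<in> tangent_space (tangent_atlas A) a"
    and "vlift A u a \<in> tangent_space (tangent_atlas A) a"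
proof -
  \<comment> \<open>The base point lies in some chart, so the choice in \<open>chart_at\<close>
    yields one around it.\<close>
  have "chart_at A (fst a) \<in> A \<and> fst a \<in> fst (chart_at A (fst a))"
    unfolding chart_at_def by (rule someI_ex) (use tangent_bundle_base[OF assms(2)] in blast)
  then have c: "tangent_chart A (chart_at A (fst a)) \<in> tangent_atlas A"
    "a \<in> fst (tangent_chart A (chart_at A (fst a)))"
    using assms(2) by (auto simp: tangent_atlas_def tangent_chart_def tangent_bundle_def)
  note t = differentiable_atlas.tangent_of_in_tangent_space[OF assms(1) c]
  show "hlift A nabla u a \<in> tangent_space (tangent_atlas A) a"
    "vlift A u a \<in> tangent_space (tangent_atlas A) a"
    unfolding hlift_def vlift_def Let_def by (rule t)+
qed

text \<open>The lifted fields at \<open>a\<close> depend on \<open>X\<close> and \<open>Y\<close>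
  only through their values at the base point, so the conditions on fields, applied to extensions of
  \<open>u\<close> and \<open>w\<close>, give the values on single vectors.\<close>

lemma hH_on_lifts:
  assumes M: "smooth_manifold M A" and hH: "is_horizontal_lift A nabla h hH"
    and a: "a \<in> tangent_bundle A" and "u \<in> tangent_space A (fst a)" "w \<in> tangent_space A (fst a)"
  shows "hH a (hlift A nabla u a) (hlift A nabla w a) = 0"
    "hH a (vlift A u a) (vlift A w a) = 0"
    "hH a (hlift A nabla u a) (vlift A w a) = h (fst a) u w"
    "hH a (vlift A u a) (hlift A nabla w a) = h (fst a) u w"
proof -
  have p: "fst a \<in> \<Union> (fst ` A)" using a by (rule tangent_bundle_base)
  obtain X where X: "vector_field A X" "X (fst a) = u" using ex_vector_field_at[OF M p assms(4)] .
  obtain Y where Y: "vector_field A Y" "Y (fst a) = w" using ex_vector_field_at[OF M p assms(5)] .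
  have "\<forall>X Y. vector_field A X \<longrightarrow> vector_field A Y \<longrightarrow> (\<forall>a\<in>tangent_bundle A.
        let XH = horizontal_lift_field A nabla X a; XV = vertical_lift_field A X a;
            YH = horizontal_lift_field A nabla Y a; YV = vertical_lift_field A Y a;
            p = fst a
        in hH a XH YH = 0 \<and> hH a XV YV = 0 \<and>
           hH a XH YV = h p (X p) (Y p) \<and> hH a XV YH = h p (X p) (Y p))"
    using hH unfolding is_horizontal_lift_def by (rule conjunct2)
  from this[rule_format, OF X(1) Y(1) a]
  show "hH a (hlift A nabla u a) (hlift A nabla w a) = 0"
    "hH a (vlift A u a) (vlift A w a) = 0"
    "hH a (hlift A nabla u a) (vlift A w a) = h (fst a) u w"
    "hH a (vlift A u a) (hlift A nabla w a) = h (fst a) u w"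
    by (simp_all add: Let_def horizontal_lift_field_def vertical_lift_field_def X(2) Y(2))
qed

text \<open>Of the four terms given by bilinearity, the purely horizontal and purely vertical ones
  vanish. In one mixed term the inverse tensor stands in the first slot and evaluates to
  \<open>\<alpha> Y\<close>; in the other it stands in the second slot and remains.\<close>

lemma hbar_eq:
  fixes A :: "('a, 'e::real_inner) chart set"
  assumes M: "smooth_manifold M A" and h: "tensor_field02 A h" "nondegenerate A h"
    and hH: "is_horizontal_lift A nabla h hH" and a: "a \<in> tangent_bundle A"
    and X: "X \<in> tangent_space A (fst a)" and \<alpha>: "\<alpha> \<in> cotangent_space A (fst a)"
    and Y: "Y \<in> tangent_space A (fst a)" and \<beta>: "\<beta> \<in> cotangent_space A (fst a)"
  shows "hbar A nabla h hH a (X, \<alpha>) (Y, \<beta>) = h (fst a) X (tensor_inv A h (fst a) \<beta>) + \<alpha> Y"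
proof -
  interpret TM: differentiable_atlas "tangent_atlas A"
    using M by (rule tangent_atlas_differentiable_atlas)
  have p: "fst a \<in> \<Union> (fst ` A)" using a by (rule tangent_bundle_base)
  then obtain c where "c \<in> A" "fst a \<in> fst c" by blast
  then have a': "a \<in> \<Union> (fst ` tangent_atlas A)"
    using a by (auto simp: tangent_atlas_def tangent_chart_def tangent_bundle_def)
  let ?T = "tangent_space (tangent_atlas A) a"
  have "tensor_field02 (tangent_atlas A) hH"
    using hH unfolding is_horizontal_lift_def by (rule conjunct1)
  then have "hH a v \<in> cotangent_space (tangent_atlas A) a"
    "(\<lambda>w. hH a w v) \<in> cotangent_space (tangent_atlas A) a" if "v \<in> ?T" for v
    using a' that unfolding tensor_field02_def by blast+
  then have add: "hH a v (vadd w w') = hH a v w + hH a v w'" "hH a (vadd w w') v = hH a w v + hH a w' v"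
    if "v \<in> ?T" "w \<in> ?T" "w' \<in> ?T" for v w w'
    using that unfolding cotangent_space_def by blast+
  note lift = lifts_in_tangent_space[OF TM.differentiable_atlas_axioms a]
  note inv = tensor_inv_works[OF M h p]
  note on_lifts = hH_on_lifts[OF M hH a]
  show ?thesis
    unfolding hbar_def Psi_def
    by (simp add: add lift TM.vadd_in_tangent_space on_lifts X Y inv \<alpha> \<beta>)
qed

theorem proposition4p3:
  fixes M :: "'a topology"
    and A :: "('a, 'e::real_inner) chart set"
    and h :: "('a, 'e) tensor02"
    and nabla :: "('a, 'e) connection"
    and hH :: "('a \<times> ('a, 'e) tvec, 'e \<times> 'e) tensor02"
  assumes "smooth_manifold M A"
    and "tensor_field02 A h"
    and "nondegenerate A h"
    and "affine_connection A nabla"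
    and "is_horizontal_lift A nabla h hH"
  shows "(symmetric_tensor A h \<longrightarrow>
           (\<forall>a\<in>tangent_bundle A.
             \<forall>\<sigma>\<in>generalized_tangent_space A (fst a). \<forall>\<tau>\<in>generalized_tangent_space A (fst a).
               hbar A nabla h hH a \<sigma> \<tau> = - 2 * pairing_sym \<sigma> \<tau>)) \<and>
         (skew_symmetric_tensor A h \<longrightarrow>
           (\<forall>a\<in>tangent_bundle A.
             \<forall>\<sigma>\<in>generalized_tangent_space A (fst a). \<forall>\<tau>\<in>generalized_tangent_space A (fst a).
               hbar A nabla h hH a \<sigma> \<tau> = - 2 * pairing_skew \<sigma> \<tau>))"
proof (intro conjI impI ballI)
  fix a \<sigma> \<tau>
  assume a: "a \<in> tangent_bundle A"
    and "\<sigma> \<in> generalized_tangent_space A (fst a)" "\<tau> \<in> generalized_tangent_space A (fst a)"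
  then obtain X \<alpha> Y \<beta> where \<sigma>: "\<sigma> = (X, \<alpha>)" and \<tau>: "\<tau> = (Y, \<beta>)"
    and X: "X \<in> tangent_space A (fst a)" and \<alpha>: "\<alpha> \<in> cotangent_space A (fst a)"
    and Y: "Y \<in> tangent_space A (fst a)" and \<beta>: "\<beta> \<in> cotangent_space A (fst a)"
    by (auto simp: generalized_tangent_space_def)
  have p: "fst a \<in> \<Union> (fst ` A)" using a by (rule tangent_bundle_base)
  note inv = tensor_inv_works[OF assms(1-3) p \<beta>]
  note eq = hbar_eq[OF assms(1-3,5) a X \<alpha> Y \<beta>]
  show "hbar A nabla h hH a \<sigma> \<tau> = - 2 * pairing_sym \<sigma> \<tau>" if "symmetric_tensor A h"
  proof -
    \<comment> \<open>Symmetry moves the inverse image of \<open>\<beta>\<close> to the first slot,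
      where \<open>h\<close> evaluates to \<open>\<beta> X\<close>.\<close>
    have "h (fst a) X (tensor_inv A h (fst a) \<beta>) = h (fst a) (tensor_inv A h (fst a) \<beta>) X"
      using that p X inv(1) unfolding symmetric_tensor_def by blast
    then show ?thesis by (simp add: \<sigma> \<tau> eq inv(2)[OF X] pairing_sym_def field_simps)
  qed
  show "hbar A nabla h hH a \<sigma> \<tau> = - 2 * pairing_skew \<sigma> \<tau>" if "skew_symmetric_tensor A h"
  proof -
    \<comment> \<open>The same exchange now costs a sign, which is the sign in the skew
      pairing.\<close>
    have "h (fst a) X (tensor_inv A h (fst a) \<beta>) = - h (fst a) (tensor_inv A h (fst a) \<beta>) X"
      using that p X inv(1) unfolding skew_symmetric_tensor_def by blast
    then show ?thesis by (simp add: \<sigma> \<tau> eq inv(2)[OF X] pairing_skew_def field_simps)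
  qed
qed

end
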